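(* Let $k\ge 2$ and $n\ge 2$ be integers. There exists an unoriented de Bruijn sequence $uB(k,n)$ of optimal length, that is, of length $$l(k,n)=\frac{k^n+k^{\lceil n/2\rceil}+2n-2}{2},$$ if and only if $n\le 3$ and ($k=2$ or $k$ is odd).
   Context: Let $\Sigma_k=\{0,1,\dots,k-1\}$ be an alphabet of $k$ symbols. A word is a finite sequence of elements of $\Sigma_k$; a subword of a word is a contiguous block of it. The reflection of a word $\bm{v}=v_1v_2\cdots v_m$ is $\bm{v}'=v_m\cdots v_2v_1$; the reflected pair of $\bm{v}$ is the class $[\bm{v}]=\{\bm{v},\bm{v}'\}$ (a single word if $\bm{v}$ is a palindrome). An unoriented de Bruijn sequence $uB(k,n)$ is a word over $\Sigma_k$ that (i) contains as a subword at least one member of each reflected pair of words of length $n$ over $\Sigma_k$, and (ii) has the shortest length among all words over $\Sigma_k$ satisfying (i). The number of reflected pairs of length $n$ is $(k^n+k^{\lceil n/2\rceil})/2$, so any word satisfying (i) has length at least $l(k,n)=(k^n+k^{\lceil n/2\rceil}+2n-2)/2$; a $uB(k,n)$ is said to have optimal length if its length equals $l(k,n)$. Unoriented de Bruijn sequences with $k=1$ or $n=1$ are called trivial; all others ($k\ge2$ and $n\ge 2$) are nontrivial. *)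

theory Defs
  imports Complex_Main "HOL-Library.Sublist"
begin

definition word_over :: "nat \<Rightarrow> nat list \<Rightarrow> bool" where
  "word_over k w \<longleftrightarrow> set w \<subseteq> {0..<k}"

definition reflected_pair :: "'a list \<Rightarrow> 'a list set" where
  "reflected_pair v = {v, rev v}"

definition reflected_pairs :: "nat \<Rightarrow> nat \<Rightarrow> nat list set set" where
  "reflected_pairs k n = {reflected_pair v | v. word_over k v \<and> length v = n}"

text \<open>Subwords are contiguous blocks, which is what \<^const>\<open>sublist\<close> denotes
  (as opposed to \<^const>\<open>subseq\<close>).\<close>

definition covers_reflected_pairs :: "nat \<Rightarrow> nat \<Rightarrow> nat list \<Rightarrow> bool" where
  "covers_reflected_pairs k n w \<longleftrightarrow> (\<forall>P \<in> reflected_pairs k n. \<exists>u \<in> P. sublist u w)"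

definition unoriented_de_bruijn :: "nat \<Rightarrow> nat \<Rightarrow> nat list \<Rightarrow> bool" where
  "unoriented_de_bruijn k n w \<longleftrightarrow>
     word_over k w \<and> covers_reflected_pairs k n w \<and>
     (\<forall>w'. word_over k w' \<and> covers_reflected_pairs k n w' \<longrightarrow> length w \<le> length w')"

text \<open>Of the \<open>k ^ n\<close> words of length \<open>n\<close>, exactly \<open>k ^ \<lceil>n / 2\<rceil>\<close> are palindromes, so there are
  \<open>(k ^ n + k ^ \<lceil>n / 2\<rceil>) / 2\<close> reflected pairs, and a word with that many blocks of length \<open>n\<close>
  is longer by \<open>n - 1\<close>.\<close>

definition optimal_length :: "nat \<Rightarrow> nat \<Rightarrow> real" where
  "optimal_length k n =
     (real k ^ n + real k ^ nat \<lceil>real n / 2\<rceil> + 2 * real n - 2) / 2"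

end

theory Submission
  imports Defs "Graph_Theory.Euler"
begin

text \<open>
  A word of length \<open>\<ell>\<close> has \<open>\<ell> + 1 - n\<close> blocks of length \<open>n\<close>, so a covering word has optimal length
  exactly when the blocks represent every reflected pair exactly once. Like the theory of Eulerian
  trails, everything then rests on comparing, for a word \<open>u\<close> of length \<open>n - 1\<close>, how often the word
  enters and leaves \<open>u\<close> or its reflection.

  Suppose that \<open>w\<close> is optimal. Every occurrence of \<open>u\<close> in \<open>w\<close> extends by one letter to the left,
  unless \<open>w\<close> begins with \<open>u\<close>, and to the right, unless \<open>w\<close> ends with \<open>u\<close>; the extensions are blocks
  of length \<open>n\<close>, whose numbers are prescribed. For \<open>u = c\<^sup>n\<^sup>-\<^sup>1\<close> the extensions number \<open>k + 1\<close> in total,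
  which for even \<open>k\<close> has the wrong parity unless \<open>u\<close> is at an end of \<open>w\<close>
  (\<open>end_at_constant_block\<close>). For \<open>n \<ge> 4\<close> and \<open>u = a\<^sup>n\<^sup>-\<^sup>2b\<close> with \<open>a \<noteq> b\<close>, one side of \<open>u\<close> has a
  palindromic extension, namely \<open>ba\<^sup>n\<^sup>-\<^sup>2b\<close>, and the other has none; as a palindrome extends both \<open>u\<close>
  and its reflection, the two sides are out of balance, and again \<open>u\<close> or its reflection is at an end
  of \<open>w\<close> (\<open>end_at_nearly_constant_block\<close>). A word has only two ends. An even \<open>k > 2\<close> gives at least
  three obstructions of the first kind, \<open>k > 2\<close> and \<open>n \<ge> 4\<close> give at least three of the second kind,
  and \<open>k = 2\<close> with \<open>n \<ge> 4\<close> gives two of each kind.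

  Conversely, the words \<open>0011\<close> and \<open>00010111\<close> settle \<open>k = 2\<close>. For odd \<open>k\<close>, put an arc from
  \<open>v\<^sub>1\<dots>v\<^sub>n\<^sub>-\<^sub>1\<close> to \<open>v\<^sub>2\<dots>v\<^sub>n\<close> for each word \<open>v\<close> of length \<open>n\<close> whose last letter minus its first letter is
  congruent modulo \<open>k\<close> to one of \<open>0, \<dots>, (k - 1) / 2\<close>. This condition picks at least one word of every
  reflected pair, and since it orients the pairs of letters as a regular tournament, it makes the
  digraph balanced. The digraph is also strongly connected, so it has a closed Eulerian trail, which
  spells a covering word with \<open>k\<^sup>n\<^sup>-\<^sup>1(k + 1) / 2\<close> blocks. For \<open>n \<in> {2, 3}\<close> that is the number of
  reflected pairs, since then \<open>\<lceil>n / 2\<rceil> = n - 1\<close>.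
\<close>

section \<open>Counting reflected pairs\<close>

definition words :: "nat \<Rightarrow> nat \<Rightarrow> nat list set" where
  "words k n = {v. word_over k v \<and> length v = n}"

lemma words_conv: "words k n = {v. set v \<subseteq> {0..<k} \<and> length v = n}"
  by (simp add: words_def word_over_def)

lemma finite_words [simp]: "finite (words k n)"
  unfolding words_conv by (rule finite_lists_length_eq) simp

lemma card_words: "card (words k n) = k ^ n"
  unfolding words_conv by (simp add: card_lists_length_eq)

lemma rev_in_words [simp]: "rev v \<in> words k n \<longleftrightarrow> v \<in> words k n"
  by (simp add: words_conv)

lemma Cons_in_words [simp]: "x # v \<in> words k (Suc n) \<longleftrightarrow> x < k \<and> v \<in> words k n"
  by (auto simp: words_conv)

lemma snoc_in_words [simp]: "v @ [x] \<in> words k (Suc n) \<longleftrightarrow> x < k \<and> v \<in> words k n"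
  by (auto simp: words_conv)

lemma words_Suc: "words k (Suc n) = (\<Union>x<k. (#) x ` words k n)"
proof -
  have "v \<in> (\<Union>x<k. (#) x ` words k n)" if "v \<in> words k (Suc n)" for v
    using that by (cases v) (auto simp: words_conv)
  then show ?thesis by auto
qed

lemma reflected_pairs_conv: "reflected_pairs k n = reflected_pair ` words k n"
  by (auto simp: reflected_pairs_def words_def)

lemma finite_reflected_pairs [simp]: "finite (reflected_pairs k n)"
  by (simp add: reflected_pairs_conv)

text \<open>Reflected pairs partition the words of length \<open>n\<close>. The weight
  \<open>f\<close> will single out palindromes, to count classes, or be the number of occurrences in a given word.\<close>

lemma sum_words_by_reflected_pairs:
  fixes f :: "nat list \<Rightarrow> nat"
  shows "(\<Sum>P\<in>reflected_pairs k n. \<Sum>v\<in>P. f v) = (\<Sum>v\<in>words k n. f v)"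
proof -
  have "{v \<in> words k n. reflected_pair v = P} = P" if "P \<in> reflected_pairs k n" for P
    using that by (auto simp: reflected_pairs_conv reflected_pair_def doubleton_eq_iff)
  then have "(\<Sum>P\<in>reflected_pairs k n. \<Sum>v\<in>P. f v)
      = (\<Sum>P\<in>reflected_pairs k n. \<Sum>v\<in>{v \<in> words k n. reflected_pair v = P}. f v)"
    by (intro sum.cong) simp_all
  also have "\<dots> = (\<Sum>v\<in>words k n. f v)"
    by (rule sum.group) (simp_all add: reflected_pairs_conv)
  finally show ?thesis .
qed

text \<open>A palindrome is determined by its first \<open>\<lceil>n / 2\<rceil>\<close> letters, which are arbitrary.\<close>

lemma card_palindromes: "card {v \<in> words k n. rev v = v} = k ^ ((n + 1) div 2)"
proof -
  define unfold where "unfold = (\<lambda>h :: nat list. h @ rev (take (n div 2) h))"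
  have "bij_betw unfold (words k ((n + 1) div 2)) {v \<in> words k n. rev v = v}"
  proof (rule bij_betwI[where g = "take ((n + 1) div 2)"])
    show "unfold \<in> words k ((n + 1) div 2) \<rightarrow> {v \<in> words k n. rev v = v}"
    proof
      fix h assume h: "h \<in> words k ((n + 1) div 2)"
      then have len: "length h = (n + 1) div 2" by (simp add: words_def)
      have "rev (unfold h) = unfold h"
      proof (cases "even n")
        case True
        then show ?thesis using len by (simp add: unfold_def)
      next
        case False
        then have "length h = Suc (n div 2)" using len by simp
        then have "h = take (n div 2) h @ [last h]"
          by (metis append_butlast_last_id butlast_conv_take diff_Suc_1 length_0_conv nat.distinct(1))
        then obtain g x where "h = g @ [x]" "length g = n div 2"
          using \<open>length h = Suc (n div 2)\<close> by (metis length_append_singleton old.nat.inject)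
        then show ?thesis by (simp add: unfold_def)
      qed
      moreover have "length (unfold h) = n"
        using len by (simp add: unfold_def)
      moreover have "set (unfold h) \<subseteq> {0..<k}"
        using h set_take_subset[of "n div 2" h] by (auto simp: unfold_def words_conv)
      ultimately show "unfold h \<in> {v \<in> words k n. rev v = v}" by (simp add: words_conv)
    qed
    show "take ((n + 1) div 2) \<in> {v \<in> words k n. rev v = v} \<rightarrow> words k ((n + 1) div 2)"
      by (auto simp: words_conv dest: in_set_takeD)
    show "take ((n + 1) div 2) (unfold h) = h" if "h \<in> words k ((n + 1) div 2)" for h
      using that by (simp add: words_def unfold_def)
    show "unfold (take ((n + 1) div 2) v) = v" if "v \<in> {v \<in> words k n. rev v = v}" for v
    proof -
      have len: "length v = n" and pal: "rev v = v" using that by (auto simp: words_def)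
      have "rev (take (n div 2) v) = drop (n - n div 2) v"
        using pal len by (metis rev_take)
      moreover have "n - n div 2 = (n + 1) div 2" "min (n div 2) ((n + 1) div 2) = n div 2"
        by auto
      ultimately show ?thesis by (simp add: unfold_def)
    qed
  qed
  from bij_betw_same_card[OF this] show ?thesis by (simp only: card_words)
qed

text \<open>Giving weight \<open>2\<close> to palindromes and \<open>1\<close> to all other words makes the total weight of every class
  \<open>2\<close>.\<close>

lemma card_reflected_pairs: "2 * card (reflected_pairs k n) = k ^ n + k ^ ((n + 1) div 2)"
proof -
  have "2 * card (reflected_pairs k n) = (\<Sum>P\<in>reflected_pairs k n. 2)" by simp
  also have "\<dots> = (\<Sum>P\<in>reflected_pairs k n. \<Sum>v\<in>P. 1 + of_bool (rev v = v))"
    by (intro sum.cong) (auto simp: reflected_pairs_conv reflected_pair_def sum.insert_if)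
  also have "\<dots> = (\<Sum>v\<in>words k n. 1 + of_bool (rev v = v))"
    by (rule sum_words_by_reflected_pairs)
  also have "\<dots> = k ^ n + k ^ ((n + 1) div 2)"
    using card_palindromes[of k n] unfolding sum.distrib
    by (simp add: card_words Int_def)
  finally show ?thesis .
qed

lemma optimal_length_conv:
  assumes "n > 0"
  shows "optimal_length k n = real (card (reflected_pairs k n) + n - 1)"
proof -
  define N where "N = card (reflected_pairs k n)"
  have "\<lceil>real n / 2\<rceil> = int ((n + 1) div 2)"
    by (rule ceiling_unique) linarith+
  then have half: "nat \<lceil>real n / 2\<rceil> = (n + 1) div 2" by (simp only: nat_int)
  have "real (k ^ n + k ^ ((n + 1) div 2)) = real (2 * N)"
    unfolding N_def card_reflected_pairs ..
  then have "optimal_length k n = real N + real n - 1"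
    unfolding optimal_length_def half by (simp add: field_simps)
  then show ?thesis using assms unfolding N_def by linarith
qed

section \<open>Counting occurrences\<close>

text \<open>Overlapping occurrences are all counted, one for each position at which \<open>u\<close> begins. The empty word
  has an occurrence in the empty word, so that it occurs \<open>length w + 1\<close> times in \<open>w\<close>; this makes the
  identities below hold without exceptions.\<close>

fun occurrences :: "'a list \<Rightarrow> 'a list \<Rightarrow> nat" where
  "occurrences u [] = of_bool (u = [])"
| "occurrences u (x # w) = of_bool (prefix u (x # w)) + occurrences u w"

lemma occurrences_pos_iff: "occurrences u w > 0 \<longleftrightarrow> sublist u w"
  by (induction w) (auto simp: sublist_Cons_right)

text \<open>Each of the \<open>length w + 1 - n\<close> positions carries exactly one block of length \<open>n\<close>.\<close>

lemma sum_occurrences_words: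
  "word_over k w \<Longrightarrow> (\<Sum>v\<in>words k n. occurrences v w) = length w + 1 - n"
proof (induction w)
  case Nil
  have "words k n \<inter> {[]} = (if n = 0 then {[]} else {})"
    by (auto simp: words_conv)
  then show ?case by simp
next
  case (Cons x w)
  have pre: "prefix v (x # w) \<longleftrightarrow> length v \<le> length (x # w) \<and> take (length v) (x # w) = v" for v
    by (metis append_eq_conv_conj prefixE prefix_length_le take_is_prefix)
  have "words k n \<inter> {v. prefix v (x # w)} = (if n \<le> length (x # w) then {take n (x # w)} else {})"
    unfolding pre using Cons.prems by (auto simp: words_def word_over_def dest!: in_set_takeD)
  then have "(\<Sum>v\<in>words k n. of_bool (prefix v (x # w))) = (of_bool (n \<le> length (x # w)) :: nat)"
    by simp
  moreover have "(\<Sum>v\<in>words k n. occurrences v w) = length w + 1 - n"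
    using Cons by (simp add: word_over_def)
  ultimately show ?case by (simp only: occurrences.simps sum.distrib) auto
qed

text \<open>Every occurrence of \<open>u\<close> is preceded by exactly one letter, except the one at the beginning of \<open>w\<close>.
  This identity and its mirror image below play the role of the degree of a vertex in an Eulerian trail.\<close>

lemma occurrences_Cons_sum:
  "word_over k w \<Longrightarrow>
     occurrences u w = (\<Sum>a<k. occurrences (a # u) w) + of_bool (prefix u w)"
proof (induction w)
  case (Cons x w)
  have "x < k" using Cons.prems by (simp add: word_over_def)
  then have "(\<Sum>a<k. of_bool (a = x \<and> prefix u w)) = (of_bool (prefix u w) :: nat)"
    by (cases "prefix u w") simp_all
  moreover have "occurrences u w = (\<Sum>a<k. occurrences (a # u) w) + of_bool (prefix u w)"
    using Cons by (simp add: word_over_def)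
  ultimately show ?case by (simp add: sum.distrib)
qed simp

lemma occurrences_snoc_sum:
  "word_over k w \<Longrightarrow>
     occurrences u w = (\<Sum>b<k. occurrences (u @ [b]) w) + of_bool (suffix u w)"
proof (induction w)
  case (Cons x w)
  have "(\<Sum>b<k. of_bool (prefix (u @ [b]) (x # w))) + of_bool (u = x # w)
      = (of_bool (prefix u (x # w)) :: nat)"
  proof (cases "prefix u (x # w)")
    case True
    then obtain t where t: "x # w = u @ t" by (auto simp: prefix_def)
    show ?thesis
    proof (cases t)
      case Nil
      then show ?thesis using t by simp
    next
      case (Cons b s)
      then have "b < k" using Cons.prems t by (simp add: word_over_def)
      moreover have "prefix (u @ [c]) (x # w) \<longleftrightarrow> c = b" for c
        by (auto simp: t Cons)
      ultimately show ?thesis using t Cons True by simp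
    qed
  next
    case False
    then have "\<not> prefix (u @ [b]) (x # w)" for b by (metis append_prefixD)
    then show ?thesis using False by auto
  qed
  moreover have "of_bool (suffix u (x # w)) = (of_bool (u = x # w) + of_bool (suffix u w) :: nat)"
    by (auto simp: suffix_Cons dest: suffix_length_le)
  moreover have "occurrences u w = (\<Sum>b<k. occurrences (u @ [b]) w) + of_bool (suffix u w)"
    using Cons by (simp add: word_over_def)
  ultimately show ?case by (simp add: sum.distrib)
qed simp

section \<open>Covering words\<close>

lemma covers_iff_occurrences:
  "covers_reflected_pairs k n w \<longleftrightarrow> (\<forall>P\<in>reflected_pairs k n. (\<Sum>v\<in>P. occurrences v w) \<ge> 1)"
proof -
  have "(\<exists>u\<in>P. sublist u w) \<longleftrightarrow> (\<Sum>v\<in>P. occurrences v w) \<ge> 1" if "P \<in> reflected_pairs k n" for P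
  proof -
    have "finite P" using that by (auto simp: reflected_pairs_conv reflected_pair_def)
    then have "(\<Sum>v\<in>P. occurrences v w) = 0 \<longleftrightarrow> (\<forall>v\<in>P. occurrences v w = 0)" by simp
    then show ?thesis by (metis occurrences_pos_iff not_gr_zero less_one not_less)
  qed
  then show ?thesis by (simp add: covers_reflected_pairs_def)
qed

text \<open>The bound of the optimal length: distinct classes need distinct positions.\<close>

lemma card_le_length_if_covers:
  assumes "word_over k w" and "covers_reflected_pairs k n w"
  shows "card (reflected_pairs k n) \<le> length w + 1 - n"
proof -
  have "card (reflected_pairs k n) = (\<Sum>P\<in>reflected_pairs k n. 1)" by simp
  also have "\<dots> \<le> (\<Sum>P\<in>reflected_pairs k n. \<Sum>v\<in>P. occurrences v w)"
    using assms(2) unfolding covers_iff_occurrences by (intro sum_mono) blast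
  also have "\<dots> = length w + 1 - n"
    using assms(1) by (simp add: sum_words_by_reflected_pairs sum_occurrences_words)
  finally show ?thesis .
qed

text \<open>A covering word that attains the lower bound is automatically of minimal length.\<close>

lemma optimal_unoriented_de_bruijnI:
  assumes "n > 0" and "k > 0" and "word_over k w" and "covers_reflected_pairs k n w"
    and len: "2 * length w + 2 = k ^ n + k ^ ((n + 1) div 2) + 2 * n"
  shows "unoriented_de_bruijn k n w \<and> real (length w) = optimal_length k n"
proof
  have eq: "length w = card (reflected_pairs k n) + n - 1"
    using len card_reflected_pairs[of k n] \<open>n > 0\<close> by linarith
  show "real (length w) = optimal_length k n"
    using eq by (simp only: optimal_length_conv[OF \<open>n > 0\<close>])
  have "card (reflected_pairs k n) > 0"
    using card_reflected_pairs[of k n] zero_less_power[OF \<open>k > 0\<close>, of n] by linarith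
  then have "length w \<le> length w'" if "word_over k w'" "covers_reflected_pairs k n w'" for w'
    using card_le_length_if_covers[OF that] eq by linarith
  then show "unoriented_de_bruijn k n w"
    using assms(3,4) unfolding unoriented_de_bruijn_def by blast
qed

text \<open>In an optimal word the classes are hit at least once each and once on average, hence exactly once.
  For a palindrome both summands count the same block, which explains the value \<open>2\<close>.\<close>

lemma occurs_once_if_optimal:
  assumes "n > 0" and "word_over k w" and "covers_reflected_pairs k n w"
    and "real (length w) = optimal_length k n" and v: "v \<in> words k n"
  shows "occurrences v w + occurrences (rev v) w = 1 + of_bool (rev v = v)"
proof -
  have len: "length w = card (reflected_pairs k n) + n - 1"
    using assms(4) by (simp only: optimal_length_conv[OF \<open>n > 0\<close>] of_nat_eq_iff)
  have "card (reflected_pairs k n) > 0"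
    using v by (auto simp: card_gt_0_iff reflected_pairs_conv)
  then have "(\<Sum>P\<in>reflected_pairs k n. \<Sum>v\<in>P. occurrences v w) = (\<Sum>P\<in>reflected_pairs k n. 1)"
    using len assms(1,2) by (simp add: sum_words_by_reflected_pairs sum_occurrences_words)
  moreover have "\<And>P. P \<in> reflected_pairs k n \<Longrightarrow> 1 \<le> (\<Sum>v\<in>P. occurrences v w)"
    using assms(3) unfolding covers_iff_occurrences by blast
  moreover have "reflected_pair v \<in> reflected_pairs k n"
    using v by (simp add: reflected_pairs_conv)
  ultimately have "(\<Sum>u\<in>reflected_pair v. occurrences u w) = 1"
    using sum_mono_inv[where f = "\<lambda>_. 1" and g = "\<lambda>P. \<Sum>v\<in>P. occurrences v w"
        and I = "reflected_pairs k n" and i = "reflected_pair v"] by simp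
  then show ?thesis
    by (cases "rev v = v") (auto simp: reflected_pair_def sum.insert_if)
qed

section \<open>Obstructions at the ends of an optimal word\<close>

text \<open>For \<open>u = c\<^sup>m\<close> the reflected pairs that extend \<open>u\<close> by one letter are \<open>[bu]\<close> for \<open>b < k\<close>, and the
  block \<open>c\<^sup>m\<^sup>+\<^sup>1\<close> extends two occurrences of \<open>u\<close>. So the extensions number \<open>k + 1\<close>, whereas an occurrence
  inside \<open>w\<close> contributes two of them.\<close>

lemma end_at_constant_block:
  assumes once: "\<And>v. v \<in> words k (Suc m) \<Longrightarrow>
      occurrences v w + occurrences (rev v) w = 1 + of_bool (rev v = v)"
    and w: "word_over k w" and "even k" and "c < k" and "m > 0"
  shows "suffix (replicate m c) w \<or> prefix (rev (replicate m c)) w"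
proof -
  define u where "u = replicate m c"
  have u: "u \<in> words k m" "rev u = u" using \<open>c < k\<close> by (auto simp: u_def words_conv)
  have pal: "u @ [b] = b # u \<longleftrightarrow> b = c" if "b < k" for b
    using \<open>m > 0\<close> unfolding u_def by (cases m) (auto simp: replicate_append_same)
  \<comment> \<open>Each occurrence is extended once to the left and once to the right, apart from the ends.\<close>
  have "2 * occurrences u w = (\<Sum>b<k. occurrences (b # u) w + occurrences (u @ [b]) w)
          + of_bool (prefix u w) + of_bool (suffix u w)"
    using occurrences_Cons_sum[OF w, of u] occurrences_snoc_sum[OF w, of u]
    by (simp add: sum.distrib)
  also have "(\<Sum>b<k. occurrences (b # u) w + occurrences (u @ [b]) w)
      = (\<Sum>b<k. 1 + of_bool (b = c))"
    using once[of "_ # u"] u pal by (intro sum.cong) auto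
  also have "\<dots> = k + 1" using \<open>c < k\<close> unfolding sum.distrib by simp
  finally have "2 * occurrences u w = k + 1 + of_bool (prefix u w) + of_bool (suffix u w)" .
  then have "prefix u w \<or> suffix u w"
    using \<open>even k\<close> by (metis add_0_right dvd_triv_left even_plus_one_iff of_bool_eq(1))
  then show ?thesis using u by (auto simp: u_def)
qed

text \<open>Let \<open>u = a\<^sup>mb\<close>. Occurrences of \<open>u\<close> and of its reflection are counted twice: by the extensions on
  the \<open>b\<close>-side of \<open>u\<close>, that is \<open>uc\<close> and its reflection, and by those on the \<open>a\<close>-side, that is \<open>cu\<close> and
  its reflection. As \<open>ba\<^sup>mb\<close> is a palindrome while no \<open>uc\<close> is one, the former number \<open>k\<close> and the
  latter \<open>k + 1\<close>; an end of \<open>w\<close> has to make up the difference. For \<open>m = 1\<close> there is no contradiction,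
  because \<open>aba\<close> is a palindrome too.\<close>

lemma end_at_nearly_constant_block:
  assumes once: "\<And>v. v \<in> words k (m + 2) \<Longrightarrow>
      occurrences v w + occurrences (rev v) w = 1 + of_bool (rev v = v)"
    and w: "word_over k w" and "m \<ge> 2" and "a < k" and "b < k" and "a \<noteq> b"
  shows "suffix (replicate m a @ [b]) w \<or> prefix (rev (replicate m a @ [b])) w"
proof -
  define u where "u = replicate m a @ [b]"
  have u: "u \<in> words k (Suc m)" using \<open>a < k\<close> \<open>b < k\<close> by (auto simp: u_def words_conv)
  obtain m' where m': "m = Suc (Suc m')" using \<open>m \<ge> 2\<close> by (metis add_2_eq_Suc le_Suc_ex)
  \<comment> \<open>The second letter of \<open>uc\<close> is \<open>a\<close> since \<open>m \<ge> 2\<close>, its last but one letter is \<open>b\<close>.\<close>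
  have not_pal: "c # rev u \<noteq> u @ [c]" for c
    using \<open>a \<noteq> b\<close> by (simp add: u_def m')
  have pal: "rev u @ [c] = c # u \<longleftrightarrow> c = b" for c
    using \<open>a \<noteq> b\<close> by (auto simp: u_def replicate_append_same)
  have "occurrences u w + occurrences (rev u) w
      = (\<Sum>c<k. occurrences (u @ [c]) w + occurrences (c # rev u) w)
          + of_bool (suffix u w) + of_bool (prefix (rev u) w)"
    using occurrences_Cons_sum[OF w, of "rev u"] occurrences_snoc_sum[OF w, of u]
    by (simp add: sum.distrib)
  also have "(\<Sum>c<k. occurrences (u @ [c]) w + occurrences (c # rev u) w) = (\<Sum>c<k. 1)"
    using once[of "u @ [_]"] u not_pal by (intro sum.cong) auto
  finally have right: "occurrences u w + occurrences (rev u) w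
      = k + of_bool (suffix u w) + of_bool (prefix (rev u) w)" by simp
  have "occurrences u w + occurrences (rev u) w
      = (\<Sum>c<k. occurrences (c # u) w + occurrences (rev u @ [c]) w)
          + of_bool (prefix u w) + of_bool (suffix (rev u) w)"
    using occurrences_Cons_sum[OF w, of u] occurrences_snoc_sum[OF w, of "rev u"]
    by (simp add: sum.distrib)
  also have "(\<Sum>c<k. occurrences (c # u) w + occurrences (rev u @ [c]) w)
      = (\<Sum>c<k. 1 + of_bool (c = b))"
    using once[of "_ # u"] u pal by (intro sum.cong) auto
  also have "\<dots> = k + 1" using \<open>b < k\<close> unfolding sum.distrib by simp
  finally show ?thesis using right unfolding u_def[symmetric]
    by (cases "suffix u w"; cases "prefix (rev u) w") simp_all
qed

lemma at_most_two_ends: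
  assumes len: "length x = m" "length y = m" "length z = m"
    and "suffix x w \<or> prefix (rev x) w"
    and "suffix y w \<or> prefix (rev y) w"
    and "suffix z w \<or> prefix (rev z) w"
  shows "x = y \<or> x = z \<or> y = z"
proof -
  have eq_suffix: "u = v" if "suffix u w" "suffix v w" "length u = length v" for u v
    using that by (metis suffix_length_suffix suffix_order.antisym le_refl)
  have eq_prefix: "u = v" if "prefix (rev u) w" "prefix (rev v) w" "length u = length v" for u v
    using that by (metis prefix_length_prefix prefix_order.antisym le_refl length_rev rev_is_rev_conv)
  consider "suffix x w" "suffix y w" | "suffix x w" "suffix z w" | "suffix y w" "suffix z w"
    | "prefix (rev x) w" "prefix (rev y) w" | "prefix (rev x) w" "prefix (rev z) w"
    | "prefix (rev y) w" "prefix (rev z) w"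
    using assms(4-6) by blast
  then show ?thesis using len eq_suffix eq_prefix by cases simp_all
qed

text \<open>Words of the form \<open>c\<^sup>m\<close> and \<open>a\<^sup>m\<^sup>-\<^sup>1b\<close> from the previous two lemmas are pairwise different, so three
  of them are too many.\<close>

lemma optimal_imp_small:
  assumes "k \<ge> 2" and "n \<ge> 2" and w: "word_over k w"
    and cov: "covers_reflected_pairs k n w" and len: "real (length w) = optimal_length k n"
  shows "n \<le> 3 \<and> (k = 2 \<or> odd k)"
proof -
  define m where "m = n - 1"
  have n: "n = Suc m" "m \<ge> 1" using \<open>n \<ge> 2\<close> by (auto simp: m_def)
  have once: "occurrences v w + occurrences (rev v) w = 1 + of_bool (rev v = v)"
    if "v \<in> words k n" for v
    using occurs_once_if_optimal[OF _ w cov len that] \<open>n \<ge> 2\<close> by simp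
  have const: "suffix (replicate m c) w \<or> prefix (rev (replicate m c)) w" if "even k" "c < k" for c
    using end_at_constant_block[OF _ w that, of m] once n by simp
  have k: "k = 2 \<or> odd k"
  proof (rule ccontr)
    assume "\<not> (k = 2 \<or> odd k)"
    then have "even k" "k > 2" using \<open>k \<ge> 2\<close> by auto
    then have "replicate m 0 = replicate m (1 :: nat) \<or> replicate m 0 = replicate m (2 :: nat)
        \<or> replicate m 1 = replicate m (2 :: nat)"
      by (intro at_most_two_ends[where w = w and m = m] const) simp_all
    then show False using n by simp
  qed
  have "n \<le> 3"
  proof (rule ccontr)
    assume "\<not> n \<le> 3"
    then obtain l where l: "m = Suc l" "l \<ge> 2" using n by (cases m) auto
    define u where "u = (\<lambda>a b :: nat. replicate l a @ [b])"
    have near: "suffix (u a b) w \<or> prefix (rev (u a b)) w" if "a < k" "b < k" "a \<noteq> b" for a b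
      unfolding u_def using end_at_nearly_constant_block[OF _ w l(2) that] once n l by simp
    have [simp]: "length (u a b) = m" for a b using l by (simp add: u_def)
    have [simp]: "u a b = u c d \<longleftrightarrow> a = c \<and> b = d" for a b c d 
      using l by (auto simp: u_def)
    have rep: "replicate m c = u c c" for c
      using l by (simp add: u_def replicate_append_same)
    show False
    proof (cases "k = 2")
      case True
      then have "u 0 0 = u 1 1 \<or> u 0 0 = u 0 1 \<or> u 1 1 = u 0 1"
        by (intro at_most_two_ends[where w = w and m = m] near const[unfolded rep]) simp_all
      then show False by simp
    next
      case False
      then have "u 0 1 = u 1 0 \<or> u 0 1 = u 0 2 \<or> u 1 0 = u 0 2"
        using \<open>k \<ge> 2\<close> by (intro at_most_two_ends[where w = w and m = m] near) simp_all
      then show False by simp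
    qed
  qed
  with k show ?thesis by simp
qed

section \<open>An Eulerian digraph for odd alphabets\<close>

text \<open>For odd \<open>k\<close> the relation "\<open>y\<close> is one of \<open>x + 1, \<dots>, x + (k - 1) / 2\<close> modulo \<open>k\<close>" is the rotational
  tournament on the letters; \<open>j = 0\<close> adds its loops. The words of length \<open>m + 1\<close> selected here are
  those whose first and last letters are so related.\<close>

definition arc_words :: "nat \<Rightarrow> nat \<Rightarrow> nat list set" where
  "arc_words k m = (\<lambda>(u, j). u @ [(hd u + j) mod k]) ` (words k m \<times> {..k div 2})"

text \<open>The subgraph of the de Bruijn graph on words of length \<open>m\<close> that keeps only the selected arcs.\<close>

definition half_de_bruijn :: "nat \<Rightarrow> nat \<Rightarrow> (nat list, nat list) pre_digraph" where
  "half_de_bruijn k m = \<lparr>verts = words k m, arcs = arc_words k m, tail = butlast, head = tl\<rparr>"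

lemma half_de_bruijn_simps [simp]:
  "verts (half_de_bruijn k m) = words k m"
  "arcs (half_de_bruijn k m) = arc_words k m"
  "tail (half_de_bruijn k m) = butlast"
  "head (half_de_bruijn k m) = tl"
  by (simp_all add: half_de_bruijn_def)

lemma mod_add_if:
  fixes x i k :: nat
  assumes "x < k" and "i \<le> k"
  shows "(x + i) mod k = (if x + i < k then x + i else x + i - k)"
  using assms by (simp add: mod_if)

lemma hd_less_if_in_words: "u \<in> words k m \<Longrightarrow> m > 0 \<Longrightarrow> hd u < k"
  by (cases u) (auto simp: words_conv)

lemma last_less_if_in_words: "u \<in> words k m \<Longrightarrow> m > 0 \<Longrightarrow> last u < k"
  by (cases u rule: rev_cases) (auto simp: words_conv)

lemma arc_words_subset: "m > 0 \<Longrightarrow> arc_words k m \<subseteq> words k (Suc m)"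
  by (fastforce simp: arc_words_def dest: hd_less_if_in_words)

lemma arc_wordsI:
  "u \<in> words k m \<Longrightarrow> j \<le> k div 2 \<Longrightarrow> u @ [(hd u + j) mod k] \<in> arc_words k m"
  unfolding arc_words_def by (rule image_eqI[of _ _ "(u, j)"]) simp_all

lemma fin_digraph_half_de_bruijn:
  assumes "m > 0"
  shows "fin_digraph (half_de_bruijn k m)"
proof
  fix e assume "e \<in> arcs (half_de_bruijn k m)"
  then have "e \<in> words k (Suc m)" using arc_words_subset[OF assms] by auto
  then show "tail (half_de_bruijn k m) e \<in> verts (half_de_bruijn k m)"
    "head (half_de_bruijn k m) e \<in> verts (half_de_bruijn k m)"
    by (cases e; auto simp: words_conv dest: in_set_butlastD)+
qed (simp_all add: arc_words_def)

lemma out_degree_half_de_bruijn: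
  assumes "m > 0" and u: "u \<in> words k m"
  shows "out_degree (half_de_bruijn k m) u = k div 2 + 1"
proof -
  have hd: "hd u < k" using hd_less_if_in_words[OF u] assms by simp
  have "out_arcs (half_de_bruijn k m) u = (\<lambda>j. u @ [(hd u + j) mod k]) ` {..k div 2}"
    using u by (auto simp: out_arcs_def arc_words_def)
  moreover have "inj_on (\<lambda>j. u @ [(hd u + j) mod k]) {..k div 2}"
    using hd by (auto simp: inj_on_def mod_add_if split: if_splits)
  ultimately show ?thesis by (simp add: out_degree_def card_image)
qed

text \<open>The letters from which \<open>last u\<close> can be reached by adding some \<open>j \<le> k div 2\<close> are
  \<open>last u - j\<close>, equally many as those in the other direction.\<close>

lemma in_degree_half_de_bruijn:
  assumes "m > 0" and u: "u \<in> words k m"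
  shows "in_degree (half_de_bruijn k m) u = k div 2 + 1"
proof -
  define pred where "pred = (\<lambda>j. (last u + (k - j)) mod k)"
  have last: "last u < k" and "u \<noteq> []"
    using last_less_if_in_words[OF u] assms by (auto simp: words_def)
  have pred: "pred j < k" "(pred j + j) mod k = last u" if "j \<le> k div 2" for j
    using that last by (auto simp: pred_def mod_add_if)
  have "in_arcs (half_de_bruijn k m) u = (\<lambda>j. pred j # u) ` {..k div 2}"
  proof (intro equalityI subsetI)
    fix e assume "e \<in> in_arcs (half_de_bruijn k m) u"
    then obtain v j where v: "v \<in> words k m" and j: "j \<le> k div 2"
      and e: "e = v @ [(hd v + j) mod k]" and tl: "tl e = u"
      by (auto simp: in_arcs_def arc_words_def)
    obtain x v' where v': "v = x # v'" using v \<open>m > 0\<close> by (cases v) (auto simp: words_def)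
    have "x < k" using v v' by (auto simp: words_conv)
    moreover have "last u = (x + j) mod k" using e tl v' by auto
    ultimately have "pred j = x" using j by (auto simp: pred_def mod_add_if)
    then show "e \<in> (\<lambda>j. pred j # u) ` {..k div 2}" using e tl v' j by auto
  next
    fix e assume "e \<in> (\<lambda>j. pred j # u) ` {..k div 2}"
    then obtain j where j: "j \<le> k div 2" and e: "e = pred j # u" by auto
    have "e = (pred j # butlast u) @ [(hd (pred j # butlast u) + j) mod k]"
      using e pred(2)[OF j] \<open>u \<noteq> []\<close> by simp
    moreover have "pred j # butlast u \<in> words k m"
      using u \<open>u \<noteq> []\<close> \<open>m > 0\<close> pred(1)[OF j] by (auto simp: words_conv dest: in_set_butlastD)
    ultimately have "e \<in> arc_words k m" using j arc_wordsI by metis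
    then show "e \<in> in_arcs (half_de_bruijn k m) u" using e by (simp add: in_arcs_def)
  qed
  moreover have "inj_on (\<lambda>j. pred j # u) {..k div 2}"
    using last by (auto simp: inj_on_def pred_def mod_add_if split: if_splits)
  ultimately show ?thesis by (simp add: in_degree_def card_image)
qed

lemma card_arc_words:
  assumes "m > 0" and "k > 0"
  shows "card (arc_words k m) = k ^ m * (k div 2 + 1)"
proof -
  have "inj_on (\<lambda>(u, j). u @ [(hd u + j) mod k]) (words k m \<times> {..k div 2})"
  proof (rule inj_onI, clarsimp)
    fix u i j
    assume u: "u \<in> words k m" and ij: "i \<le> k div 2" "j \<le> k div 2"
      and eq: "(hd u + i) mod k = (hd u + j) mod k"
    have "hd u < k" using hd_less_if_in_words[OF u] assms by simp
    with ij eq show "i = j" by (auto simp: mod_add_if split: if_splits)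
  qed
  then show ?thesis
    unfolding arc_words_def by (simp add: card_image card_cartesian_product card_words)
qed

text \<open>Choosing \<open>j = 0\<close> rotates a word, and choosing \<open>j = 1\<close> increases a letter while rotating it to the
  end. Full turns thus change a single letter to any other one, so the letters of a word can be
  replaced one after the other.\<close>

lemma strongly_connected_half_de_bruijn:
  assumes "m > 0" and "k > 1"
  shows "strongly_connected (half_de_bruijn k m)"
proof -
  interpret fin_digraph "half_de_bruijn k m" by (rule fin_digraph_half_de_bruijn[OF assms(1)])
  let ?reach = "\<lambda>u v. u \<rightarrow>\<^sup>*\<^bsub>half_de_bruijn k m\<^esub> v"
  have step: "?reach (x # r) (r @ [(x + j) mod k])"
    if "x # r \<in> words k m" "j \<le> k div 2" for x r j
  proof -
    have "((x # r) @ [(hd (x # r) + j) mod k]) \<in> arc_words k m"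
      using that by (rule arc_wordsI)
    then have "(x # r, r @ [(x + j) mod k]) \<in> arcs_ends (half_de_bruijn k m)"
      unfolding arcs_ends_conv by (force intro!: image_eqI)
    then show ?thesis by (rule reachable_adjI)
  qed
  have rotate: "?reach (u @ v) (v @ u)" if "u @ v \<in> words k m" for u v
    using that
  proof (induction u arbitrary: v)
    case Nil
    then show ?case by (simp add: reachable_refl)
  next
    case (Cons x u)
    have "x < k" using Cons.prems by (auto simp: words_conv)
    then have "?reach ((x # u) @ v) (u @ v @ [x])"
      using step[of x "u @ v" 0] Cons.prems by simp
    moreover have "?reach (u @ v @ [x]) ((v @ [x]) @ u)"
      using Cons.IH[of "v @ [x]"] Cons.prems by (auto simp: words_conv)
    ultimately show ?case using reachable_trans by simp
  qed
  have increase: "?reach (x # r) ((x + j) mod k # r)" if "x # r \<in> words k m" for x r j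
  proof (induction j)
    case 0
    then show ?case using that by (auto simp: words_conv intro: reachable_refl)
  next
    case (Suc j)
    have in_words: "y mod k # r \<in> words k m" for y
      using that \<open>k > 1\<close> by (auto simp: words_conv)
    have "?reach ((x + j) mod k # r) (r @ [((x + j) mod k + 1) mod k])"
      using step[OF in_words, of 1] \<open>k > 1\<close> by simp
    moreover have "((x + j) mod k + 1) mod k = (x + Suc j) mod k"
      by (simp add: mod_Suc_eq)
    moreover have "?reach (r @ [(x + Suc j) mod k]) ([(x + Suc j) mod k] @ r)"
      using in_words[of "x + Suc j"] by (intro rotate) (auto simp: words_conv)
    ultimately show ?case using Suc reachable_trans by (metis append_Cons append_Nil)
  qed
  have change: "?reach (x # r) (y # r)" if "x # r \<in> words k m" "y < k" for x y r
  proof -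
    have "x < k" using that(1) by (auto simp: words_conv)
    then have "(x + (k - x + y)) mod k = y" using \<open>y < k\<close> by simp
    then show ?thesis using increase[OF that(1)] by metis
  qed
  \<comment> \<open>The letters of \<open>a\<close> leave on the left while those of \<open>b\<close> enter on the right.\<close>
  have "?reach (a @ r) (r @ b)"
    if "length a = length b" "a @ r \<in> words k m" "set b \<subseteq> {0..<k}" for a b r
    using that
  proof (induction a b arbitrary: r rule: list_induct2)
    case Nil
    then show ?case by (simp add: reachable_refl)
  next
    case (Cons x a y b)
    have "?reach ((x # a) @ r) (y # a @ r)"
      using change[of x "a @ r" y] Cons.prems by simp
    also have "?reach (y # a @ r) ((a @ r) @ [y])"
      using rotate[of "[y]" "a @ r"] Cons.prems by (auto simp: words_conv)
    also have "?reach ((a @ r) @ [y]) ((r @ [y]) @ b)"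
      using Cons.IH[of "r @ [y]"] Cons.prems by (auto simp: words_conv)
    finally show ?case by simp
  qed
  from this[of _ _ "[]"] have "?reach u v" if "u \<in> words k m" "v \<in> words k m" for u v
    using that by (simp add: words_conv)
  moreover have "replicate m 0 \<in> words k m" using \<open>k > 1\<close> by (auto simp: words_conv)
  ultimately show ?thesis by (intro strongly_connectedI) auto
qed

text \<open>A walk spells the word that appends to its first vertex the letter added by each arc.\<close>

lemma arcs_are_subwords_of_walk:
  assumes "pre_digraph.cas (half_de_bruijn k m) u p v" and "[] \<notin> set p" and "e \<in> set p"
  shows "sublist e (u @ map last p)"
  using assms
proof (induction p arbitrary: u)
  case (Cons d p)
  have d: "d \<noteq> []" "butlast d = u" and walk: "pre_digraph.cas (half_de_bruijn k m) (tl d) p v"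
    using Cons.prems by (auto simp: pre_digraph.cas.simps)
  then have word: "u @ map last (d # p) = d @ map last p"
    by (metis append.assoc append_Cons append_Nil append_butlast_last_id list.simps(9))
  show ?case
  proof (cases "e = d")
    case True
    then show ?thesis unfolding word by simp
  next
    case False
    then have "sublist e (tl d @ map last p)" using Cons walk by auto
    also have "sublist \<dots> (d @ map last p)"
      using d by (cases d) (auto intro: sublist_Cons_right[THEN iffD2])
    finally show ?thesis unfolding word .
  qed
qed simp

text \<open>For letters \<open>x\<close> and \<open>y\<close> one of \<open>y - x\<close> and \<open>x - y\<close> has its residue in \<open>{0, \<dots>, (k - 1) / 2}\<close>, because
  the residues add up to \<open>0\<close> or to the odd number \<open>k\<close>.\<close>

lemma arc_words_cover:
  assumes "odd k" and "m > 0" and v: "v \<in> words k (Suc m)"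
  shows "v \<in> arc_words k m \<or> rev v \<in> arc_words k m"
proof -
  have arc: "u @ [y] \<in> arc_words k m"
    if "u \<in> words k m" "y < k" "j \<le> k div 2" "(hd u + j) mod k = y" for u y j
    using arc_wordsI[OF that(1,3)] that(4) by simp
  obtain x r y where v_eq: "v = x # r @ [y]"
    using v \<open>m > 0\<close> by (cases v; cases "tl v" rule: rev_cases) (auto simp: words_def)
  have xy: "x < k" "y < k" and in_words: "x # r \<in> words k m" "y # rev r \<in> words k m"
    using v by (auto simp: v_eq words_conv)
  have "\<exists>j \<le> k div 2. (x + j) mod k = y \<or> (y + j) mod k = x"
  proof -
    define d where "d = (if x \<le> y then y - x else x - y)"
    have "d \<le> k div 2 \<or> k - d \<le> k div 2" using \<open>odd k\<close> by presburger
    moreover have "(x + d) mod k = y \<or> (y + d) mod k = x"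
      "(x + (k - d)) mod k = y \<or> (y + (k - d)) mod k = x"
      using xy by (auto simp: d_def mod_add_if)
    ultimately show ?thesis by blast
  qed
  then show ?thesis using arc[OF in_words(1)] arc[OF in_words(2)] xy by (auto simp: v_eq)
qed

lemma ex_optimal_if_odd:
  assumes "odd k" and "k > 1" and "n = 2 \<or> n = 3"
  shows "\<exists>w. unoriented_de_bruijn k n w \<and> real (length w) = optimal_length k n"
proof -
  define m where "m = n - 1"
  have m: "m > 0" "n = Suc m" using assms(3) by (auto simp: m_def)
  interpret fin_digraph "half_de_bruijn k m" by (rule fin_digraph_half_de_bruijn[OF m(1)])
  have "connected (half_de_bruijn k m)"
    using strongly_connected_half_de_bruijn[OF m(1) \<open>k > 1\<close>]
    unfolding connected_def strongly_connected_def
    by (auto intro: reachable_mk_symmetricI)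
  then obtain u p where "euler_trail u p u"
    using closed_euler1 in_degree_half_de_bruijn[OF m(1)] out_degree_half_de_bruijn[OF m(1)]
    by fastforce
  then have u: "u \<in> words k m" and p: "set p = arc_words k m" "distinct p" and walk: "cas u p u"
    by (auto simp: euler_trail_def trail_def awalk_def)
  define w where "w = u @ map last p"
  have arcs: "e \<in> words k n" if "e \<in> set p" for e
    using that p arc_words_subset[OF m(1)] m by auto
  have "word_over k w"
    using u arcs last_less_if_in_words[of _ k n] m by (auto simp: w_def word_over_def words_conv)
  moreover have "covers_reflected_pairs k n w"
  proof -
    have "[] \<notin> set p" using arcs[of "[]"] m by (auto simp: words_def)
    from arcs_are_subwords_of_walk[OF walk this] have "sublist e w" if "e \<in> arc_words k m" for e
      using that p by (simp add: w_def)
    then show ?thesis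
      using arc_words_cover[OF \<open>odd k\<close> m(1)] m
      by (auto simp: covers_reflected_pairs_def reflected_pairs_conv reflected_pair_def)
  qed
  moreover have "2 * length w + 2 = k ^ n + k ^ ((n + 1) div 2) + 2 * n"
  proof -
    have "length w = m + k ^ m * (k div 2 + 1)"
      using u p card_arc_words[OF m(1), of k] \<open>k > 1\<close> distinct_card[OF p(2)]
      by (simp add: w_def words_def)
    moreover have "2 * (k div 2 + 1) = k + 1" using \<open>odd k\<close> by presburger
    then have "2 * (k ^ m * (k div 2 + 1)) = k ^ m * (k + 1)"
      by (metis mult.left_commute)
    \<comment> \<open>The step that fails for \<open>n \<ge> 4\<close>, where the trail is longer than optimal.\<close>
    moreover have "(n + 1) div 2 = m" using assms(3) by (auto simp: m_def)
    ultimately show ?thesis using m by (simp add: algebra_simps)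
  qed
  ultimately have "unoriented_de_bruijn k n w \<and> real (length w) = optimal_length k n"
    using m \<open>k > 1\<close> by (intro optimal_unoriented_de_bruijnI) auto
  then show ?thesis by blast
qed

section \<open>The binary alphabet and the classification\<close>

lemma ex_optimal_binary:
  assumes "n = 2 \<or> n = 3"
  shows "\<exists>w. unoriented_de_bruijn 2 n w \<and> real (length w) = optimal_length 2 n"
proof -
  have "{..<2 :: nat} = {0, 1}" by auto
  then have words_Suc_2: "words 2 (Suc m) = (#) 0 ` words 2 m \<union> (#) 1 ` words 2 m" for m
    by (simp add: words_Suc)
  have words_0: "words 2 0 = {[]}" by (auto simp: words_conv)
  have words_2: "words 2 2 = {[0,0],[0,1],[1,0],[1,1]}"
    using words_Suc_2[of 1] words_Suc_2[of 0] words_0 by (simp add: numeral_2_eq_2 insert_commute)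
  have words_3: "words 2 3 = {[0,0,0],[0,0,1],[0,1,0],[0,1,1],[1,0,0],[1,0,1],[1,1,0],[1,1,1]}"
    using words_Suc_2[of 2] words_2 by (simp add: insert_commute)
  have "covers_reflected_pairs 2 2 [0,0,1,1]"
    by (simp add: covers_reflected_pairs_def reflected_pairs_conv reflected_pair_def words_2
        sublist_Cons_right)
  then have "unoriented_de_bruijn 2 2 [0,0,1,1] \<and> real (length [0::nat,0,1,1]) = optimal_length 2 2"
    by (intro optimal_unoriented_de_bruijnI) (simp_all add: word_over_def)
  moreover have "covers_reflected_pairs 2 3 [0,0,0,1,0,1,1,1]"
    by (simp add: covers_reflected_pairs_def reflected_pairs_conv reflected_pair_def words_3
        sublist_Cons_right)
  then have "unoriented_de_bruijn 2 3 [0,0,0,1,0,1,1,1]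
      \<and> real (length [0::nat,0,0,1,0,1,1,1]) = optimal_length 2 3"
    by (intro optimal_unoriented_de_bruijnI) (simp_all add: word_over_def)
  ultimately show ?thesis using assms by blast
qed

theorem theorem4p3:
  fixes k n :: nat
  assumes "k \<ge> 2" and "n \<ge> 2"
  shows "(\<exists>w. unoriented_de_bruijn k n w \<and> real (length w) = optimal_length k n)
           \<longleftrightarrow> n \<le> 3 \<and> (k = 2 \<or> odd k)"
proof
  assume "\<exists>w. unoriented_de_bruijn k n w \<and> real (length w) = optimal_length k n"
  then show "n \<le> 3 \<and> (k = 2 \<or> odd k)"
    using optimal_imp_small[OF assms] by (auto simp: unoriented_de_bruijn_def)
next
  assume "n \<le> 3 \<and> (k = 2 \<or> odd k)"
  moreover have "n = 2 \<or> n = 3" if "n \<le> 3" using that assms by linarith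
  ultimately show "\<exists>w. unoriented_de_bruijn k n w \<and> real (length w) = optimal_length k n"
    using ex_optimal_binary ex_optimal_if_odd assms by force
qed

end
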